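(* Let $(\mathcal C,\Box,0,\eta)$ be a directed monoidal category with a strict unit. That is, $\Box:\mathcal C\times\mathcal C\to\mathcal C$ is a bifunctor, and $0$ is an object of $\mathcal C$ which serves as a strict unit for $\Box$, i.e. the restrictions of $\Box$ to $0\times\mathcal C$ and $\mathcal C\times 0$ are the identity; and $$\eta_{A,B,C}:(A\Box B)\Box C\longrightarrow A\Box(B\Box C)$$ is a natural transformation (not necessarily an isomorphism) such that $\eta_{A,B,C}$ is the identity whenever one of $A,B,C$ is $0$, and such that the pentagonal diagram commutes, i.e. for all objects $A,B,C,D$ $$\eta_{A,B,C\Box D}\circ\eta_{A\Box B,C,D}=(id_A\Box\eta_{B,C,D})\circ\eta_{A,B\Box C,D}\circ(\eta_{A,B,C}\Box id_D)$$ as morphisms $((A\Box B)\Box C)\Box D\to A\Box(B\Box(C\Box D))$. Then $\mathcal C$ can be endowed with the structure of an $A_\infty$-monoidal category.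
   Context: An $A_\infty$-monoidal category is a category $\mathcal C$ with functors $\mu_k:\mathcal C^k\to\mathcal C$ for all $k\ge0$ such that (1) $\mu_1$ is the identity functor; (2) $\mu_0:*\to\mathcal C$ is an object $0$ which is a strict unit: $\mu_k(Id_{\mathcal C}^{\,i}\times 0\times Id_{\mathcal C}^{\,j})=\mu_{k-1}$ whenever $i+j=k-1$; together with natural transformations $\alpha^{i,j,k}:\mu_{i+1+k}\circ(Id_{\mathcal C}^{\,i}\times\mu_j\times Id_{\mathcal C}^{\,k})\to\mu_{i+j+k}$ for all $i,j,k\ge0$ such that, for objects $\overline A,\overline B,\overline C,\overline D,\overline E$ of $\mathcal C^a,\mathcal C^b,\mathcal C^c,\mathcal C^d,\mathcal C^e$ (where $\alpha^{i,j,k}_{\overline X,\overline Y,\overline Z}$ denotes the component at $(\overline X,\overline Y,\overline Z)\in\mathcal C^i\times\mathcal C^j\times\mathcal C^k$): (i) $\alpha^{i,0,k}$, $\alpha^{i,1,k}$ and $\alpha^{0,j,0}$ are identities. (ii) $\alpha^{a+b+1,c,d}_{(\overline A,0,\overline B),\overline C,\overline D}=\alpha^{a+b,c,d}_{(\overline A,\overline B),\overline C,\overline D}$. (iii) $\alpha^{a,b,c+d+1}_{\overline A,\overline B,(\overline C,0,\overline D)}=\alpha^{a,b,c+d}_{\overline A,\overline B,(\overline C,\overline D)}$. (iv) $\alpha^{a,b+c+1,d}_{\overline A,(\overline B,0,\overline C),\overline D}=\alpha^{a,b+c,d}_{\overline A,(\overline B,\overline C),\overline D}$. (v) $\alpha^{a+b+c,d,e}_{(\overline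 A,\overline B,\overline C),\overline D,\overline E}\circ\alpha^{a,b,c+e+1}_{\overline A,\overline B,(\overline C,\mu_d(\overline D),\overline E)}=\alpha^{a,b,c+d+e}_{\overline A,\overline B,(\overline C,\overline D,\overline E)}\circ\alpha^{a+c+1,d,e}_{(\overline A,\mu_b(\overline B),\overline C),\overline D,\overline E}$. (vi) $\alpha^{a,b+c+d,e}_{\overline A,(\overline B,\overline C,\overline D),\overline E}\circ\mu_{a+e+1}(id_{\overline A},\alpha^{b,c,d}_{\overline B,\overline C,\overline D},id_{\overline E})=\alpha^{a+b,c,d+e}_{(\overline A,\overline B),\overline C,(\overline D,\overline E)}\circ\alpha^{a,b+d+1,e}_{\overline A,(\overline B,\mu_c(\overline C),\overline D),\overline E}$. *)

theory Defs
  imports Main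
begin

section \<open>Categories, functors and natural transformations\<close>

record ('o, 'm) category =
  Obj :: "'o set"
  Mor :: "'m set"
  Dom :: "'m \<Rightarrow> 'o"
  Cod :: "'m \<Rightarrow> 'o"
  Ident :: "'o \<Rightarrow> 'm"
  Comp :: "'m \<Rightarrow> 'm \<Rightarrow> 'm"  (infixl "\<cdot>\<index>" 70)

text \<open>Composition is written in applicative order: \<open>g \<cdot>\<^bsub>C\<^esub> f\<close> means first \<open>f\<close>, then \<open>g\<close>.\<close>

definition Hom :: "('o, 'm) category \<Rightarrow> 'o \<Rightarrow> 'o \<Rightarrow> 'm set"
  where "Hom C A B = {f \<in> Mor C. Dom C f = A \<and> Cod C f = B}"

locale category =
  fixes C :: "('o, 'm) category"  (structure)
  assumes Dom_Obj: "f \<in> Mor C \<Longrightarrow> Dom C f \<in> Obj C"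
    and Cod_Obj: "f \<in> Mor C \<Longrightarrow> Cod C f \<in> Obj C"
    and Ident_Hom: "A \<in> Obj C \<Longrightarrow> Ident C A \<in> Hom C A A"
    and Comp_Hom: "\<lbrakk>f \<in> Hom C X Y; g \<in> Hom C Y Z\<rbrakk> \<Longrightarrow> g \<cdot> f \<in> Hom C X Z"
    and Comp_Ident: "f \<in> Hom C X Y \<Longrightarrow> f \<cdot> Ident C X = f"
    and Ident_Comp: "f \<in> Hom C X Y \<Longrightarrow> Ident C Y \<cdot> f = f"
    and Comp_assoc: "\<lbrakk>f \<in> Hom C W X; g \<in> Hom C X Y; h \<in> Hom C Y Z\<rbrakk>
          \<Longrightarrow> h \<cdot> g \<cdot> f = h \<cdot> (g \<cdot> f)"

record ('o, 'm, 'p, 'n) functr =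
  fobj :: "'o \<Rightarrow> 'p"
  fmor :: "'m \<Rightarrow> 'n"

locale is_functor = source: category C + target: category D
  for C :: "('o, 'm) category" and D :: "('p, 'n) category" +
  fixes F :: "('o, 'm, 'p, 'n) functr"
  assumes fobj_Obj: "A \<in> Obj C \<Longrightarrow> fobj F A \<in> Obj D"
    and fmor_Hom: "f \<in> Hom C A B \<Longrightarrow> fmor F f \<in> Hom D (fobj F A) (fobj F B)"
    and fmor_Ident: "A \<in> Obj C \<Longrightarrow> fmor F (Ident C A) = Ident D (fobj F A)"
    and fmor_Comp: "\<lbrakk>f \<in> Hom C X Y; g \<in> Hom C Y Z\<rbrakk>
          \<Longrightarrow> fmor F (g \<cdot>\<^bsub>C\<^esub> f) = fmor F g \<cdot>\<^bsub>D\<^esub> fmor F f"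

text \<open>The underlying HOL functions of a functor are arbitrary outside its source category, so
  equality of functors is agreement on the objects and morphisms of the source.\<close>

definition functr_eq ::
  "('o, 'm) category \<Rightarrow> ('o, 'm, 'p, 'n) functr \<Rightarrow> ('o, 'm, 'p, 'n) functr \<Rightarrow> bool"
  where "functr_eq C F G \<longleftrightarrow>
    (\<forall>A \<in> Obj C. fobj F A = fobj G A) \<and> (\<forall>f \<in> Mor C. fmor F f = fmor G f)"

definition functr_comp ::
  "('p, 'n, 'q, 'r) functr \<Rightarrow> ('o, 'm, 'p, 'n) functr \<Rightarrow> ('o, 'm, 'q, 'r) functr"
    (infixr "\<circ>\<circ>" 55)
  where "G \<circ>\<circ> F = \<lparr>fobj = fobj G \<circ> fobj F, fmor = fmor G \<circ> fmor F\<rparr>"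

locale nat_transf = F: is_functor C D F + G: is_functor C D G
  for C :: "('o, 'm) category" and D :: "('p, 'n) category" and F G +
  fixes t :: "'o \<Rightarrow> 'n"
  assumes component_Hom: "A \<in> Obj C \<Longrightarrow> t A \<in> Hom D (fobj F A) (fobj G A)"
    and naturality: "f \<in> Hom C A B \<Longrightarrow> t B \<cdot>\<^bsub>D\<^esub> fmor F f = fmor G f \<cdot>\<^bsub>D\<^esub> t A"


section \<open>Products and powers of categories\<close>

definition prod_cat ::
  "('o, 'm) category \<Rightarrow> ('p, 'n) category \<Rightarrow> ('o \<times> 'p, 'm \<times> 'n) category"
  where "prod_cat C D =
    \<lparr>Obj = Obj C \<times> Obj D,
     Mor = Mor C \<times> Mor D,
     Dom = map_prod (Dom C) (Dom D),
     Cod = map_prod (Cod C) (Cod D),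
     Ident = map_prod (Ident C) (Ident D),
     Comp = (\<lambda>(g, g') (f, f'). (g \<cdot>\<^bsub>C\<^esub> f, g' \<cdot>\<^bsub>D\<^esub> f'))\<rparr>"

text \<open>Objects and morphisms of \<open>C\<^sup>k\<close> are lists of length \<open>k\<close>; concatenation of lists is the
  identification of \<open>C\<^sup>i \<times> C\<^sup>j\<close> with \<open>C\<close> to the power \<open>i + j\<close>. In particular the power \<open>0\<close> is the
  category with the single object \<open>[]\<close> and the single morphism \<open>[]\<close>.\<close>

definition pow_cat :: "('o, 'm) category \<Rightarrow> nat \<Rightarrow> ('o list, 'm list) category"
  where "pow_cat C k =
    \<lparr>Obj = {As. length As = k \<and> set As \<subseteq> Obj C},
     Mor = {fs. length fs = k \<and> set fs \<subseteq> Mor C},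
     Dom = map (Dom C),
     Cod = map (Cod C),
     Ident = map (Ident C),
     Comp = map2 (Comp C)\<rparr>"

text \<open>For \<open>F : C\<^sup>j \<rightarrow> C\<close>, the functor \<open>at_slot i j F\<close> is \<open>Id\<^sup>i \<times> F \<times> Id\<^sup>k\<close>, from \<open>C\<close> to the power
  \<open>i + j + k\<close> to \<open>C\<close> to the power \<open>i + 1 + k\<close>; the value of \<open>k\<close> is read off from the length of the
  argument.\<close>

definition at_slot ::
  "nat \<Rightarrow> nat \<Rightarrow> ('o list, 'm list, 'o, 'm) functr \<Rightarrow> ('o list, 'm list, 'o list, 'm list) functr"
  where "at_slot i j F =
    \<lparr>fobj = (\<lambda>As. take i As @ [fobj F (take j (drop i As))] @ drop (i + j) As),
     fmor = (\<lambda>fs. take i fs @ [fmor F (take j (drop i fs))] @ drop (i + j) fs)\<rparr>"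


section \<open>Directed monoidal categories with a strict unit\<close>

locale directed_monoidal = category C + tensor: is_functor "prod_cat C C" C T
  for C :: "('o, 'm) category" and T :: "('o \<times> 'o, 'm \<times> 'm, 'o, 'm) functr" +
  fixes zero :: 'o
    and \<eta> :: "'o \<Rightarrow> 'o \<Rightarrow> 'o \<Rightarrow> 'm"
  assumes zero_Obj: "zero \<in> Obj C"
    and unit_left: "functr_eq C
          \<lparr>fobj = (\<lambda>A. fobj T (zero, A)), fmor = (\<lambda>f. fmor T (Ident C zero, f))\<rparr>
          \<lparr>fobj = (\<lambda>A. A), fmor = (\<lambda>f. f)\<rparr>"
    and unit_right: "functr_eq C
          \<lparr>fobj = (\<lambda>A. fobj T (A, zero)), fmor = (\<lambda>f. fmor T (f, Ident C zero))\<rparr>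
          \<lparr>fobj = (\<lambda>A. A), fmor = (\<lambda>f. f)\<rparr>"
    and \<eta>_natural: "nat_transf (prod_cat C (prod_cat C C)) C
          \<lparr>fobj = (\<lambda>(X, Y, Z). fobj T (fobj T (X, Y), Z)),
           fmor = (\<lambda>(f, g, h). fmor T (fmor T (f, g), h))\<rparr>
          \<lparr>fobj = (\<lambda>(X, Y, Z). fobj T (X, fobj T (Y, Z))),
           fmor = (\<lambda>(f, g, h). fmor T (f, fmor T (g, h)))\<rparr>
          (\<lambda>(X, Y, Z). \<eta> X Y Z)"
    and \<eta>_unit: "\<lbrakk>X \<in> Obj C; Y \<in> Obj C; Z \<in> Obj C; X = zero \<or> Y = zero \<or> Z = zero\<rbrakk>
          \<Longrightarrow> \<eta> X Y Z = Ident C (fobj T (X, fobj T (Y, Z)))"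
    and pentagon: "\<lbrakk>W \<in> Obj C; X \<in> Obj C; Y \<in> Obj C; Z \<in> Obj C\<rbrakk> \<Longrightarrow>
          \<eta> W X (fobj T (Y, Z)) \<cdot>\<^bsub>C\<^esub> \<eta> (fobj T (W, X)) Y Z =
          fmor T (Ident C W, \<eta> X Y Z) \<cdot>\<^bsub>C\<^esub> \<eta> W (fobj T (X, Y)) Z \<cdot>\<^bsub>C\<^esub>
            fmor T (\<eta> W X Y, Ident C Z)"


section \<open>A-infinity-monoidal categories\<close>

text \<open>The component of \<open>\<alpha> i j k\<close> at \<open>(X, Y, Z)\<close>, with \<open>X\<close>, \<open>Y\<close>, \<open>Z\<close> of lengths \<open>i\<close>, \<open>j\<close>, \<open>k\<close>,
  is \<open>\<alpha> i j k (X @ Y @ Z)\<close>. The unit object is \<open>fobj (\<mu> 0) []\<close>, and the functor that inserts it at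
  position \<open>i\<close> is \<open>at_slot i 0 (\<mu> 0)\<close>.\<close>

locale A_infinity_monoidal = category C
  for C :: "('o, 'm) category" (structure) +
  fixes \<mu> :: "nat \<Rightarrow> ('o list, 'm list, 'o, 'm) functr"
    and \<alpha> :: "nat \<Rightarrow> nat \<Rightarrow> nat \<Rightarrow> 'o list \<Rightarrow> 'm"
  assumes \<mu>_functor: "\<And>k. is_functor (pow_cat C k) C (\<mu> k)"
    and \<mu>_one: "functr_eq (pow_cat C 1) (\<mu> 1) \<lparr>fobj = (\<lambda>As. As ! 0), fmor = (\<lambda>fs. fs ! 0)\<rparr>"
    and \<mu>_unit: "\<And>i j. functr_eq (pow_cat C (i + j))
          (\<mu> (i + 1 + j) \<circ>\<circ> at_slot i 0 (\<mu> 0)) (\<mu> (i + j))"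
    and \<alpha>_natural: "\<And>i j k. nat_transf (pow_cat C (i + j + k)) C
          (\<mu> (i + 1 + k) \<circ>\<circ> at_slot i j (\<mu> j)) (\<mu> (i + j + k)) (\<alpha> i j k)"
    and \<alpha>_ident_0: "\<And>i k X. X \<in> Obj (pow_cat C (i + k)) \<Longrightarrow>
          \<alpha> i 0 k X = Ident C (fobj (\<mu> (i + k)) X)"
    and \<alpha>_ident_1: "\<And>i k X. X \<in> Obj (pow_cat C (i + 1 + k)) \<Longrightarrow>
          \<alpha> i 1 k X = Ident C (fobj (\<mu> (i + 1 + k)) X)"
    and \<alpha>_ident_all: "\<And>j X. X \<in> Obj (pow_cat C j) \<Longrightarrow>
          \<alpha> 0 j 0 X = Ident C (fobj (\<mu> j) X)"
    and \<alpha>_unit_left: "\<And>a b c d X Y Z W.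
          \<lbrakk>X \<in> Obj (pow_cat C a); Y \<in> Obj (pow_cat C b);
           Z \<in> Obj (pow_cat C c); W \<in> Obj (pow_cat C d)\<rbrakk> \<Longrightarrow>
          \<alpha> (a + b + 1) c d ((X @ [fobj (\<mu> 0) []] @ Y) @ Z @ W) =
          \<alpha> (a + b) c d ((X @ Y) @ Z @ W)"
    and \<alpha>_unit_right: "\<And>a b c d X Y Z W.
          \<lbrakk>X \<in> Obj (pow_cat C a); Y \<in> Obj (pow_cat C b);
           Z \<in> Obj (pow_cat C c); W \<in> Obj (pow_cat C d)\<rbrakk> \<Longrightarrow>
          \<alpha> a b (c + d + 1) (X @ Y @ (Z @ [fobj (\<mu> 0) []] @ W)) =
          \<alpha> a b (c + d) (X @ Y @ (Z @ W))"
    and \<alpha>_unit_middle: "\<And>a b c d X Y Z W.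
          \<lbrakk>X \<in> Obj (pow_cat C a); Y \<in> Obj (pow_cat C b);
           Z \<in> Obj (pow_cat C c); W \<in> Obj (pow_cat C d)\<rbrakk> \<Longrightarrow>
          \<alpha> a (b + c + 1) d (X @ (Y @ [fobj (\<mu> 0) []] @ Z) @ W) =
          \<alpha> a (b + c) d (X @ (Y @ Z) @ W)"
    and \<alpha>_disjoint: "\<And>a b c d e X Y Z W V.
          \<lbrakk>X \<in> Obj (pow_cat C a); Y \<in> Obj (pow_cat C b); Z \<in> Obj (pow_cat C c);
           W \<in> Obj (pow_cat C d); V \<in> Obj (pow_cat C e)\<rbrakk> \<Longrightarrow>
          \<alpha> (a + b + c) d e ((X @ Y @ Z) @ W @ V) \<cdot>
            \<alpha> a b (c + e + 1) (X @ Y @ (Z @ [fobj (\<mu> d) W] @ V)) =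
          \<alpha> a b (c + d + e) (X @ Y @ (Z @ W @ V)) \<cdot>
            \<alpha> (a + c + 1) d e ((X @ [fobj (\<mu> b) Y] @ Z) @ W @ V)"
    and \<alpha>_nested: "\<And>a b c d e X Y Z W V.
          \<lbrakk>X \<in> Obj (pow_cat C a); Y \<in> Obj (pow_cat C b); Z \<in> Obj (pow_cat C c);
           W \<in> Obj (pow_cat C d); V \<in> Obj (pow_cat C e)\<rbrakk> \<Longrightarrow>
          \<alpha> a (b + c + d) e (X @ (Y @ Z @ W) @ V) \<cdot>
            fmor (\<mu> (a + e + 1))
              (map (Ident C) X @ [\<alpha> b c d (Y @ Z @ W)] @ map (Ident C) V) =
          \<alpha> (a + b) c (d + e) ((X @ Y) @ Z @ (W @ V)) \<cdot>
            \<alpha> a (b + d + 1) e (X @ (Y @ [fobj (\<mu> c) Z] @ W) @ V)"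

end

theory Submission
  imports Defs
begin

text \<open>The product \<open>\<mu>\<^sub>k\<close> is the right-bracketed one, \<open>A\<^sub>1 \<box> (A\<^sub>2 \<box> (\<dots> \<box> (A\<^sub>k \<box> 0)))\<close>. Moving brackets with \<open>\<eta>\<close>
  yields natural morphisms \<open>\<beta>\<^sub>B\<^sub>,\<^sub>P\<close> from \<open>\<mu>(B) \<box> P\<close> to \<open>B\<^sub>1 \<box> (\<dots> \<box> (B\<^sub>j \<box> P))\<close>, and \<open>\<alpha>\<^sub>A\<^sub>,\<^sub>B\<^sub>,\<^sub>C\<close> is
  \<open>\<beta>\<close> at \<open>(B, \<mu>(C))\<close>, tensored on the left with the identities of \<open>A\<close>. Condition (v) is then the
  naturality of \<open>\<beta>\<close> in \<open>P\<close>. Condition (vi) reduces by naturality of \<open>\<eta>\<close> to the case where the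
  outer product begins with the inner one, and this case follows from the pentagon by induction
  on the length of the inner product.\<close>

section \<open>Powers of categories\<close>

lemma HomD:
  assumes "f \<in> Hom C A B"
  shows "f \<in> Mor C" "Dom C f = A" "Cod C f = B"
  using assms by (auto simp: Hom_def)

lemma Mor_Hom: "f \<in> Mor C \<Longrightarrow> f \<in> Hom C (Dom C f) (Cod C f)"
  by (simp add: Hom_def)

lemma Obj_pow_cat [simp]: "As \<in> Obj (pow_cat C k) \<longleftrightarrow> length As = k \<and> set As \<subseteq> Obj C"
  by (simp add: pow_cat_def)

lemma Hom_pow_cat:
  "fs \<in> Hom (pow_cat C k) As Bs \<longleftrightarrow>
    length fs = k \<and> set fs \<subseteq> Mor C \<and> map (Dom C) fs = As \<and> map (Cod C) fs = Bs"
  by (auto simp: pow_cat_def Hom_def)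

lemma Ident_pow_cat: "Ident (pow_cat C k) = map (Ident C)"
  by (simp add: pow_cat_def)

lemma Comp_pow_cat: "gs \<cdot>\<^bsub>pow_cat C k\<^esub> fs = map2 (Comp C) gs fs"
  by (simp add: pow_cat_def)

context category
begin

lemma Ident_simps:
  assumes "A \<in> Obj C"
  shows "Ident C A \<in> Mor C" "Dom C (Ident C A) = A" "Cod C (Ident C A) = A"
  using Ident_Hom[OF assms] by (auto simp: Hom_def)

lemma Hom_Obj:
  assumes "f \<in> Hom C A B"
  shows "A \<in> Obj C" "B \<in> Obj C"
  using assms Dom_Obj Cod_Obj by (auto simp: Hom_def)

lemma map_Ident:
  assumes "set As \<subseteq> Obj C"
  shows "set (map (Ident C) As) \<subseteq> Mor C"
    "map (Dom C) (map (Ident C) As) = As" "map (Cod C) (map (Ident C) As) = As"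
  using assms by (induction As) (auto simp: Ident_simps)

lemma map_Dom_Obj: "set fs \<subseteq> Mor C \<Longrightarrow> set (map (Dom C) fs) \<subseteq> Obj C"
  using Dom_Obj by auto

lemma map_Cod_Obj: "set fs \<subseteq> Mor C \<Longrightarrow> set (map (Cod C) fs) \<subseteq> Obj C"
  using Cod_Obj by auto

lemma Comp_simps:
  assumes "f \<in> Mor C" "g \<in> Mor C" "Dom C g = Cod C f"
  shows "g \<cdot> f \<in> Mor C" "Dom C (g \<cdot> f) = Dom C f" "Cod C (g \<cdot> f) = Cod C g"
  using Comp_Hom[OF Mor_Hom[OF assms(1)], of g "Cod C g"] assms by (auto simp: Hom_def)

lemma map2_Comp:
  assumes "set fs \<subseteq> Mor C" "set gs \<subseteq> Mor C" "map (Dom C) gs = map (Cod C) fs"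
  shows "set (map2 (Comp C) gs fs) \<subseteq> Mor C"
    "map (Dom C) (map2 (Comp C) gs fs) = map (Dom C) fs"
    "map (Cod C) (map2 (Comp C) gs fs) = map (Cod C) gs"
proof -
  \<comment> \<open>\<open>map2\<close> cuts to the shorter list, so equality of the lengths is
    first read off from the matching of domains with codomains.\<close>
  have "length gs = length fs"
    using assms(3) by (metis length_map)
  then have "set (map2 (Comp C) gs fs) \<subseteq> Mor C \<and>
      map (Dom C) (map2 (Comp C) gs fs) = map (Dom C) fs \<and>
      map (Cod C) (map2 (Comp C) gs fs) = map (Cod C) gs"
    using assms by (induction gs fs rule: list_induct2) (auto simp: Comp_simps)
  then show "set (map2 (Comp C) gs fs) \<subseteq> Mor C"
    "map (Dom C) (map2 (Comp C) gs fs) = map (Dom C) fs"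
    "map (Cod C) (map2 (Comp C) gs fs) = map (Cod C) gs"
    by blast+
qed

lemma map2_Comp_Ident:
  "set fs \<subseteq> Mor C \<Longrightarrow> map2 (Comp C) fs (map (Ident C) (map (Dom C) fs)) = fs"
  by (induction fs) (auto intro: Comp_Ident Mor_Hom)

lemma map2_Ident_Comp:
  "set fs \<subseteq> Mor C \<Longrightarrow> map2 (Comp C) (map (Ident C) (map (Cod C) fs)) fs = fs"
  by (induction fs) (auto intro: Ident_Comp Mor_Hom)

lemma map2_Comp_assoc:
  assumes "set fs \<subseteq> Mor C" "set gs \<subseteq> Mor C" "set hs \<subseteq> Mor C"
    "map (Dom C) gs = map (Cod C) fs" "map (Dom C) hs = map (Cod C) gs"
  shows "map2 (Comp C) (map2 (Comp C) hs gs) fs = map2 (Comp C) hs (map2 (Comp C) gs fs)"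
proof -
  have "length hs = length gs" "length gs = length fs"
    using assms(4,5) by (metis length_map)+
  then show ?thesis
    using assms
    by (induction hs gs fs rule: list_induct3) (auto simp: Hom_def intro!: Comp_assoc)
qed

lemma category_pow_cat: "category (pow_cat C k)"
proof
  show "Dom (pow_cat C k) f \<in> Obj (pow_cat C k)" "Cod (pow_cat C k) f \<in> Obj (pow_cat C k)"
    if "f \<in> Mor (pow_cat C k)" for f
    using that Dom_Obj Cod_Obj by (auto simp: pow_cat_def)
  show "Ident (pow_cat C k) A \<in> Hom (pow_cat C k) A A" if "A \<in> Obj (pow_cat C k)" for A
    using that map_Ident[of A] by (simp add: Hom_pow_cat Ident_pow_cat)
  show "g \<cdot>\<^bsub>pow_cat C k\<^esub> f \<in> Hom (pow_cat C k) X Z"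
    if "f \<in> Hom (pow_cat C k) X Y" "g \<in> Hom (pow_cat C k) Y Z" for f g X Y Z
    using that map2_Comp[of f g] by (auto simp: Hom_pow_cat Comp_pow_cat)
  show "f \<cdot>\<^bsub>pow_cat C k\<^esub> Ident (pow_cat C k) X = f"
    "Ident (pow_cat C k) Y \<cdot>\<^bsub>pow_cat C k\<^esub> f = f"
    if "f \<in> Hom (pow_cat C k) X Y" for f X Y
    using that map2_Comp_Ident[of f] map2_Ident_Comp[of f]
    by (auto simp: Hom_pow_cat Comp_pow_cat Ident_pow_cat)
  show "h \<cdot>\<^bsub>pow_cat C k\<^esub> g \<cdot>\<^bsub>pow_cat C k\<^esub> f = h \<cdot>\<^bsub>pow_cat C k\<^esub> (g \<cdot>\<^bsub>pow_cat C k\<^esub> f)"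
    if "f \<in> Hom (pow_cat C k) W X" "g \<in> Hom (pow_cat C k) X Y" "h \<in> Hom (pow_cat C k) Y Z"
    for f g h W X Y Z
    using that by (auto simp: Hom_pow_cat Comp_pow_cat intro!: map2_Comp_assoc)
qed

end

section \<open>Composite functors and functors acting on one block of a power\<close>

lemma is_functor_comp:
  assumes "is_functor C D F" "is_functor D E G"
  shows "is_functor C E (G \<circ>\<circ> F)"
proof -
  interpret F: is_functor C D F by fact
  interpret G: is_functor D E G by fact
  show ?thesis
    by unfold_locales
      (auto simp: functr_comp_def F.fobj_Obj G.fobj_Obj F.fmor_Ident G.fmor_Ident
        F.fmor_Comp G.fmor_Comp[OF F.fmor_Hom F.fmor_Hom] intro: F.fmor_Hom G.fmor_Hom)
qed

text \<open>Cutting a list into blocks commutes with domains, codomains, identities and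
  componentwise composition, so each functor law reduces to the law of \<open>F\<close> on the
  middle block.\<close>

lemma is_functor_at_slot:
  assumes "is_functor (pow_cat C j) C F"
  shows "is_functor (pow_cat C (i + j + k)) (pow_cat C (i + 1 + k)) (at_slot i j F)"
proof -
  interpret F: is_functor "pow_cat C j" C F by fact
  interpret source: category "pow_cat C (i + j + k)"
    by (rule F.target.category_pow_cat)
  interpret target: category "pow_cat C (i + 1 + k)"
    by (rule F.target.category_pow_cat)
  have mid: "take j (drop i fs) \<in> Hom (pow_cat C j) (take j (drop i As)) (take j (drop i Bs))"
    if "fs \<in> Hom (pow_cat C (i + j + k)) As Bs" for fs As Bs
    using that by (auto simp: Hom_pow_cat take_map drop_map dest!: in_set_takeD in_set_dropD)
  show ?thesis
  proof unfold_locales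
    fix As assume As: "As \<in> Obj (pow_cat C (i + j + k))"
    then have "take j (drop i As) \<in> Obj (pow_cat C j)"
      by (auto dest!: in_set_takeD in_set_dropD)
    note mid_As = F.fobj_Obj[OF this] F.fmor_Ident[OF this]
    show "fobj (at_slot i j F) As \<in> Obj (pow_cat C (i + 1 + k))"
      using As mid_As by (auto simp: at_slot_def dest!: in_set_takeD in_set_dropD)
    show "fmor (at_slot i j F) (Ident (pow_cat C (i + j + k)) As) =
        Ident (pow_cat C (i + 1 + k)) (fobj (at_slot i j F) As)"
      using mid_As by (simp add: at_slot_def Ident_pow_cat take_map drop_map)
  next
    fix fs As Bs assume fs: "fs \<in> Hom (pow_cat C (i + j + k)) As Bs"
    show "fmor (at_slot i j F) fs \<in> Hom (pow_cat C (i + 1 + k))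
        (fobj (at_slot i j F) As) (fobj (at_slot i j F) Bs)"
      using fs HomD[OF F.fmor_Hom[OF mid[OF fs]]]
      by (auto simp: at_slot_def Hom_pow_cat take_map drop_map
          dest!: in_set_takeD in_set_dropD)
  next
    fix fs gs Xs Ys Zs
    assume fs: "fs \<in> Hom (pow_cat C (i + j + k)) Xs Ys"
      and gs: "gs \<in> Hom (pow_cat C (i + j + k)) Ys Zs"
    show "fmor (at_slot i j F) (gs \<cdot>\<^bsub>pow_cat C (i + j + k)\<^esub> fs) =
        fmor (at_slot i j F) gs \<cdot>\<^bsub>pow_cat C (i + 1 + k)\<^esub> fmor (at_slot i j F) fs"
      using fs gs F.fmor_Comp[OF mid[OF fs] mid[OF gs]]
      by (simp add: at_slot_def Hom_pow_cat Comp_pow_cat take_map drop_map take_zip drop_zip)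
  qed
qed

section \<open>Right-bracketed products\<close>

context directed_monoidal
begin

no_notation Comp (infixl "\<cdot>\<index>" 70)

abbreviation compose (infixl "\<cdot>" 70)
  where "g \<cdot> f \<equiv> Comp C g f"

abbreviation tensor_obj (infixr "\<box>" 75)
  where "A \<box> B \<equiv> fobj T (A, B)"

abbreviation tensor_mor (infixr "\<otimes>" 75)
  where "f \<otimes> g \<equiv> fmor T (f, g)"

text \<open>The second argument is the innermost right factor. Leaving it general makes
  \<open>product (As @ Bs) P\<close> equal to \<open>product As (product Bs P)\<close> without any
  associativity of the tensor.\<close>

abbreviation product :: "'o list \<Rightarrow> 'o \<Rightarrow> 'o"
  where "product \<equiv> foldr (\<box>)"

abbreviation product_mor :: "'m list \<Rightarrow> 'm \<Rightarrow> 'm"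
  where "product_mor \<equiv> foldr (\<otimes>)"

abbreviation whisker :: "'o list \<Rightarrow> 'm \<Rightarrow> 'm"
  where "whisker As \<equiv> product_mor (map (Ident C) As)"

lemma tensor_Obj: "\<lbrakk>A \<in> Obj C; B \<in> Obj C\<rbrakk> \<Longrightarrow> A \<box> B \<in> Obj C"
  using tensor.fobj_Obj[of "(A, B)"] by (simp add: prod_cat_def)

lemma tensor_Hom:
  assumes "f \<in> Hom C A B" "g \<in> Hom C A' B'"
  shows "f \<otimes> g \<in> Hom C (A \<box> A') (B \<box> B')"
  using tensor.fmor_Hom[of "(f, g)" "(A, A')" "(B, B')"] assms
  by (simp add: prod_cat_def Hom_def)

lemma tensor_Ident:
  "\<lbrakk>A \<in> Obj C; B \<in> Obj C\<rbrakk> \<Longrightarrow> Ident C A \<otimes> Ident C B = Ident C (A \<box> B)"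
  using tensor.fmor_Ident[of "(A, B)"] by (simp add: prod_cat_def)

lemma interchange:
  assumes "f \<in> Hom C X Y" "g \<in> Hom C Y Z" "f' \<in> Hom C X' Y'" "g' \<in> Hom C Y' Z'"
  shows "(g \<otimes> g') \<cdot> (f \<otimes> f') = (g \<cdot> f) \<otimes> (g' \<cdot> f')"
  using tensor.fmor_Comp[of "(f, f')" "(X, X')" "(Y, Y')" "(g, g')" "(Z, Z')"] assms
  by (simp add: prod_cat_def Hom_def)

lemma unit_Obj:
  assumes "A \<in> Obj C"
  shows "zero \<box> A = A" "A \<box> zero = A"
  using unit_left unit_right assms by (auto simp: functr_eq_def)

lemma unit_Hom:
  assumes "f \<in> Hom C A B"
  shows "Ident C zero \<otimes> f = f" "f \<otimes> Ident C zero = f"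
  using unit_left unit_right HomD(1)[OF assms] by (auto simp: functr_eq_def)

lemma eta_Hom:
  assumes "X \<in> Obj C" "Y \<in> Obj C" "Z \<in> Obj C"
  shows "\<eta> X Y Z \<in> Hom C ((X \<box> Y) \<box> Z) (X \<box> Y \<box> Z)"
  using nat_transf.component_Hom[OF \<eta>_natural, of "(X, Y, Z)"] assms
  by (simp add: prod_cat_def)

lemma eta_naturality:
  assumes "f \<in> Hom C X X'" "g \<in> Hom C Y Y'" "h \<in> Hom C Z Z'"
  shows "\<eta> X' Y' Z' \<cdot> ((f \<otimes> g) \<otimes> h) = (f \<otimes> g \<otimes> h) \<cdot> \<eta> X Y Z"
  using nat_transf.naturality[OF \<eta>_natural, of "(f, g, h)" "(X, Y, Z)" "(X', Y', Z')"] assms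
  by (simp add: prod_cat_def Hom_def)

section \<open>Functoriality of iterated products\<close>

lemma product_Obj: "\<lbrakk>set As \<subseteq> Obj C; P \<in> Obj C\<rbrakk> \<Longrightarrow> product As P \<in> Obj C"
  by (induction As) (auto simp: tensor_Obj)

lemma product_Hom:
  "\<lbrakk>set fs \<subseteq> Mor C; p \<in> Hom C P Q\<rbrakk> \<Longrightarrow>
    product_mor fs p \<in> Hom C (product (map (Dom C) fs) P) (product (map (Cod C) fs) Q)"
  by (induction fs) (auto intro: tensor_Hom Mor_Hom)

lemma product_Ident:
  "\<lbrakk>set As \<subseteq> Obj C; P \<in> Obj C\<rbrakk> \<Longrightarrow> whisker As (Ident C P) = Ident C (product As P)"
  by (induction As) (auto simp: tensor_Ident product_Obj)

text \<open>Iterated interchange law. The whiskering lemmas below are the cases where one or both of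
  the lists consist of identities.\<close>

lemma product_Comp:
  assumes "set fs \<subseteq> Mor C" "set gs \<subseteq> Mor C" "map (Dom C) gs = map (Cod C) fs"
    and p: "p \<in> Hom C P Q" and q: "q \<in> Hom C Q R"
  shows "product_mor gs q \<cdot> product_mor fs p = product_mor (map2 (Comp C) gs fs) (q \<cdot> p)"
proof -
  have "length gs = length fs"
    using assms(3) by (metis length_map)
  then show ?thesis
    using assms(1-3)
  proof (induction gs fs rule: list_induct2)
    case (Cons g gs f fs)
    have "f \<in> Hom C (Dom C f) (Cod C f)" "g \<in> Hom C (Cod C f) (Cod C g)"
      "product_mor fs p \<in> Hom C (product (map (Dom C) fs) P) (product (map (Cod C) fs) Q)"
      "product_mor gs q \<in> Hom C (product (map (Cod C) fs) Q) (product (map (Cod C) gs) R)"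
      using Cons.prems product_Hom[OF _ p, of fs] product_Hom[OF _ q, of gs]
      by (auto simp: Hom_def)
    from interchange[OF this] show ?case
      using Cons by simp
  qed simp
qed

lemma whisker_Hom:
  assumes "set As \<subseteq> Obj C" "f \<in> Hom C P Q"
  shows "whisker As f \<in> Hom C (product As P) (product As Q)"
  using product_Hom[OF map_Ident(1)[OF assms(1)] assms(2)] map_Ident[OF assms(1)] by simp

lemma whisker_product:
  assumes "set fs \<subseteq> Mor C" "p \<in> Hom C P Q" "q \<in> Hom C Q R"
  shows "whisker (map (Cod C) fs) q \<cdot> product_mor fs p = product_mor fs (q \<cdot> p)"
  using product_Comp[of fs "map (Ident C) (map (Cod C) fs)" p P Q q R] assms
    map_Ident[OF map_Cod_Obj[OF assms(1)]] map2_Ident_Comp[OF assms(1)] by simp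

lemma product_whisker:
  assumes "set fs \<subseteq> Mor C" "p \<in> Hom C P Q" "q \<in> Hom C Q R"
  shows "product_mor fs q \<cdot> whisker (map (Dom C) fs) p = product_mor fs (q \<cdot> p)"
  using product_Comp[of "map (Ident C) (map (Dom C) fs)" fs p P Q q R] assms
    map_Ident[OF map_Dom_Obj[OF assms(1)]] map2_Comp_Ident[OF assms(1)] by simp

lemma whisker_Comp:
  assumes "set As \<subseteq> Obj C" "p \<in> Hom C P Q" "q \<in> Hom C Q R"
  shows "whisker As q \<cdot> whisker As p = whisker As (q \<cdot> p)"
  using whisker_product[OF map_Ident(1)[OF assms(1)] assms(2,3)]
  by (simp only: map_Ident[OF assms(1)])

text \<open>The inserted \<open>zero\<close> stands to the left of the object
  \<open>product Bs P\<close>, even when \<open>Bs\<close> is empty, so the left unit law absorbs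
  it.\<close>

lemma product_unit:
  assumes "set As \<subseteq> Obj C" "set Bs \<subseteq> Obj C" "P \<in> Obj C"
  shows "product (As @ zero # Bs) P = product (As @ Bs) P"
  using assms by (simp add: unit_Obj product_Obj)

section \<open>Rebracketing\<close>

text \<open>This is the \<beta> of the overview: \<eta> first frees \<open>B\<close> from the
  bracket, then the recursion opens the rest of the block under \<open>B\<close>. The middle
  argument of \<eta> ends in \<open>zero\<close> because the block being opened is a value of
  \<mu>.\<close>

fun rebracket :: "'o list \<Rightarrow> 'o \<Rightarrow> 'm"
  where
    "rebracket [] P = Ident C P"
  | "rebracket (B # Bs) P = (Ident C B \<otimes> rebracket Bs P) \<cdot> \<eta> B (product Bs zero) P"

lemma rebracket_Hom:
  assumes "set Bs \<subseteq> Obj C" and P: "P \<in> Obj C"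
  shows "rebracket Bs P \<in> Hom C (product Bs zero \<box> P) (product Bs P)"
  using assms(1)
proof (induction Bs)
  case Nil
  \<comment> \<open>For the empty block the source is \<open>zero \<box> P\<close>, which is
    \<open>P\<close> itself by strictness of the unit.\<close>
  then show ?case using P by (simp add: unit_Obj Ident_Hom)
next
  case (Cons B Bs)
  then have "\<eta> B (product Bs zero) P \<in>
        Hom C ((B \<box> product Bs zero) \<box> P) (B \<box> product Bs zero \<box> P)"
      "Ident C B \<otimes> rebracket Bs P \<in> Hom C (B \<box> product Bs zero \<box> P) (B \<box> product Bs P)"
    using P by (auto intro: eta_Hom tensor_Hom Ident_Hom product_Obj zero_Obj)
  from Comp_Hom[OF this] show ?case by simp
qed

text \<open>Naturality of \<eta> carries the first factor \<open>f\<close> past \<eta>, and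
  induction treats the remaining factors under the tensor with \<open>f\<close>. The factors and the
  end object vary together because naturality of \<alpha> needs both at once.\<close>

lemma rebracket_natural:
  assumes "set fs \<subseteq> Mor C" and p: "p \<in> Hom C P Q"
  shows "rebracket (map (Cod C) fs) Q \<cdot> (product_mor fs (Ident C zero) \<otimes> p) =
    product_mor fs p \<cdot> rebracket (map (Dom C) fs) P"
  using assms(1)
proof (induction fs)
  case Nil
  show ?case
    using p by (simp add: unit_Hom Comp_Ident Ident_Comp)
next
  case (Cons f fs)
  let ?D = "map (Dom C) fs" and ?E = "map (Cod C) fs"
  let ?m = "product_mor fs (Ident C zero)"
  have obj: "set ?D \<subseteq> Obj C" "set ?E \<subseteq> Obj C" "P \<in> Obj C" "Q \<in> Obj C"
    "product ?D zero \<in> Obj C" "product ?E zero \<in> Obj C" "Dom C f \<in> Obj C" "Cod C f \<in> Obj C"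
    using Cons.prems map_Dom_Obj[of fs] map_Cod_Obj[of fs] Hom_Obj[OF p] zero_Obj Dom_Obj Cod_Obj
    by (auto intro!: product_Obj)
  have f: "f \<in> Hom C (Dom C f) (Cod C f)"
    using Cons.prems by (simp add: Mor_Hom)
  have m: "?m \<in> Hom C (product ?D zero) (product ?E zero)"
    using Cons.prems zero_Obj by (auto intro: product_Hom Ident_Hom)
  have fp: "product_mor fs p \<in> Hom C (product ?D P) (product ?E Q)"
    using Cons.prems p by (auto intro: product_Hom)
  note bD = rebracket_Hom[OF obj(1,3)] and bE = rebracket_Hom[OF obj(2,4)]
  note idD = Ident_Hom[OF obj(7)] and idE = Ident_Hom[OF obj(8)]
  have "rebracket (map (Cod C) (f # fs)) Q \<cdot> (product_mor (f # fs) (Ident C zero) \<otimes> p) =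
      (Ident C (Cod C f) \<otimes> rebracket ?E Q) \<cdot>
        (\<eta> (Cod C f) (product ?E zero) Q \<cdot> ((f \<otimes> ?m) \<otimes> p))"
    using Comp_assoc[OF tensor_Hom[OF tensor_Hom[OF f m] p] eta_Hom[OF obj(8,6,4)]
        tensor_Hom[OF idE bE]] by simp
  also have "\<dots> = (Ident C (Cod C f) \<otimes> rebracket ?E Q) \<cdot>
        ((f \<otimes> ?m \<otimes> p) \<cdot> \<eta> (Dom C f) (product ?D zero) P)"
    by (simp only: eta_naturality[OF f m p])
  also have "\<dots> = ((Ident C (Cod C f) \<otimes> rebracket ?E Q) \<cdot> (f \<otimes> ?m \<otimes> p)) \<cdot>
        \<eta> (Dom C f) (product ?D zero) P"
    using Comp_assoc[OF eta_Hom[OF obj(7,5,3)] tensor_Hom[OF f tensor_Hom[OF m p]]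
        tensor_Hom[OF idE bE]] by simp
  \<comment> \<open>Interchange collects everything to the right of \<open>f\<close> in one tensor
    factor, which then has the shape of the induction hypothesis.\<close>
  also have "(Ident C (Cod C f) \<otimes> rebracket ?E Q) \<cdot> (f \<otimes> ?m \<otimes> p) =
      f \<otimes> (rebracket ?E Q \<cdot> (?m \<otimes> p))"
    using interchange[OF f idE tensor_Hom[OF m p] bE] by (simp add: Ident_Comp[OF f])
  also have "\<dots> = f \<otimes> (product_mor fs p \<cdot> rebracket ?D P)"
    using Cons by simp
  also have "\<dots> = (f \<otimes> product_mor fs p) \<cdot> (Ident C (Dom C f) \<otimes> rebracket ?D P)"
    using interchange[OF idD f bD fp] by (simp add: Comp_Ident[OF f])
  also have "\<dots> \<cdot> \<eta> (Dom C f) (product ?D zero) P =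
      product_mor (f # fs) p \<cdot> rebracket (map (Dom C) (f # fs)) P"
    using Comp_assoc[OF eta_Hom[OF obj(7,5,3)] tensor_Hom[OF idD bD] tensor_Hom[OF f fp]]
    by simp
  finally show ?case .
qed

text \<open>Naturality in the end object alone, obtained by taking identities for the factors; this
  is the source of condition (v).\<close>

lemma rebracket_whisker:
  assumes Bs: "set Bs \<subseteq> Obj C" and p: "p \<in> Hom C P Q"
  shows "rebracket Bs Q \<cdot> (Ident C (product Bs zero) \<otimes> p) = whisker Bs p \<cdot> rebracket Bs P"
  using rebracket_natural[OF map_Ident(1)[OF Bs] p]
  by (simp only: map_Ident[OF Bs] product_Ident[OF Bs zero_Obj])

section \<open>Unit laws for rebracketing\<close>

text \<open>The only \<eta> involved has middle argument \<open>zero\<close>, hence is an identity.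
  This settles \<alpha> with a middle block of length one.\<close>

lemma rebracket_singleton:
  assumes "B \<in> Obj C" "P \<in> Obj C"
  shows "rebracket [B] P = Ident C (B \<box> P)"
  using assms zero_Obj \<eta>_unit[of B zero P]
  by (simp add: unit_Obj tensor_Ident tensor_Obj Ident_Comp[OF Ident_Hom])

text \<open>Every \<eta> in the recursion has last argument \<open>zero\<close>. This settles
  \<alpha> with empty outer blocks.\<close>

lemma rebracket_zero:
  "set Bs \<subseteq> Obj C \<Longrightarrow> rebracket Bs zero = Ident C (product Bs zero)"
proof (induction Bs)
  case (Cons B Bs)
  then have obj: "B \<in> Obj C" "product Bs zero \<in> Obj C"
    using zero_Obj by (auto intro: product_Obj)
  then show ?case
    using Cons zero_Obj \<eta>_unit[of B "product Bs zero" zero]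
    by (simp add: unit_Obj tensor_Ident tensor_Obj Ident_Comp[OF Ident_Hom])
qed simp

text \<open>Once \<open>zero\<close> is reached, its \<eta> is an identity and tensoring with
  \<open>Ident C zero\<close> changes nothing; before that, both sides use the same \<eta> because
  the products agree.\<close>

lemma rebracket_unit:
  assumes "set As \<subseteq> Obj C" "set Bs \<subseteq> Obj C" and P: "P \<in> Obj C"
  shows "rebracket (As @ zero # Bs) P = rebracket (As @ Bs) P"
  using assms(1)
proof (induction As)
  case Nil
  have obj: "product Bs zero \<in> Obj C" "product Bs zero \<box> P \<in> Obj C"
    using assms zero_Obj by (auto intro: product_Obj tensor_Obj)
  have "rebracket (zero # Bs) P = rebracket Bs P \<cdot> Ident C (product Bs zero \<box> P)"
    using unit_Hom(1)[OF rebracket_Hom[OF assms(2) P]] \<eta>_unit[of zero "product Bs zero" P]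
      obj P zero_Obj by (simp add: unit_Obj)
  then show ?case
    using Comp_Ident[OF rebracket_Hom[OF assms(2) P]] by simp
next
  case (Cons A As)
  then show ?case
    using assms(2) zero_Obj by (simp add: unit_Obj product_Obj)
qed

section \<open>Nested rebracketing and the pentagon\<close>

text \<open>Naturality of \<eta> in its middle argument, after which \<open>p\<close> and
  \<open>q\<close> merge under \<open>A\<close>. It is the shared inductive step of
  \<open>rebracket_append\<close> and \<open>rebracket_nested\<close>, where \<open>q\<close> is the
  rebracketing of a tail.\<close>

lemma eta_rebracket:
  assumes A: "A \<in> Obj C" and P: "P \<in> Obj C"
    and p: "p \<in> Hom C X Y" and q: "q \<in> Hom C (Y \<box> P) Q"
  shows "((Ident C A \<otimes> q) \<cdot> \<eta> A Y P) \<cdot> ((Ident C A \<otimes> p) \<otimes> Ident C P) =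
    (Ident C A \<otimes> (q \<cdot> (p \<otimes> Ident C P))) \<cdot> \<eta> A X P"
proof -
  note idA = Ident_Hom[OF A] and idP = Ident_Hom[OF P] and obj = Hom_Obj[OF p]
  note pP = tensor_Hom[OF p idP]
  have "((Ident C A \<otimes> q) \<cdot> \<eta> A Y P) \<cdot> ((Ident C A \<otimes> p) \<otimes> Ident C P) =
      (Ident C A \<otimes> q) \<cdot> (\<eta> A Y P \<cdot> ((Ident C A \<otimes> p) \<otimes> Ident C P))"
    by (rule Comp_assoc[OF tensor_Hom[OF tensor_Hom[OF idA p] idP] eta_Hom[OF A obj(2) P]
        tensor_Hom[OF idA q]])
  also have "\<dots> = (Ident C A \<otimes> q) \<cdot> ((Ident C A \<otimes> p \<otimes> Ident C P) \<cdot> \<eta> A X P)"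
    by (simp only: eta_naturality[OF idA p idP])
  also have "\<dots> = ((Ident C A \<otimes> q) \<cdot> (Ident C A \<otimes> p \<otimes> Ident C P)) \<cdot> \<eta> A X P"
    by (rule Comp_assoc[symmetric, OF eta_Hom[OF A obj(1) P] tensor_Hom[OF idA pP]
        tensor_Hom[OF idA q]])
  also have "(Ident C A \<otimes> q) \<cdot> (Ident C A \<otimes> p \<otimes> Ident C P) =
      Ident C A \<otimes> (q \<cdot> (p \<otimes> Ident C P))"
    using interchange[OF idA idA pP q] by (simp add: Ident_Comp[OF idA])
  finally show ?thesis .
qed

text \<open>Both sides start at \<open>(product As zero \<box> product Bs zero) \<box> P\<close>.
  The left side opens the block \<open>As\<close> first; the right side treats it as a single factor
  and opens it last. The pentagon enters once for each factor in \<open>As\<close>.\<close>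

lemma rebracket_append:
  assumes "set As \<subseteq> Obj C" and Bs: "set Bs \<subseteq> Obj C" and P: "P \<in> Obj C"
  shows "rebracket (As @ Bs) P \<cdot> (rebracket As (product Bs zero) \<otimes> Ident C P) =
    rebracket As (product Bs P) \<cdot> rebracket (product As zero # Bs) P"
  using assms(1)
proof (induction As)
  case Nil
  have obj: "product Bs zero \<in> Obj C" "product Bs P \<in> Obj C" "product Bs zero \<box> P \<in> Obj C"
    using Bs P zero_Obj by (auto intro: product_Obj tensor_Obj)
  \<comment> \<open>As \<open>product [] zero\<close> is \<open>zero\<close>, the claim compares the
    lists \<open>zero # Bs\<close> and \<open>Bs\<close>; the recursion stays folded so that
    \<open>rebracket_unit\<close> applies.\<close>
  show ?case
    using obj rebracket_unit[of "[]" Bs P] Bs P rebracket_Hom[OF Bs P]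
    by (simp add: tensor_Ident Comp_Ident Ident_Comp del: rebracket.simps(2))
next
  case (Cons A As)
  let ?X = "product As zero" and ?Y = "product Bs zero" and ?Q = "product Bs P"
  have A: "A \<in> Obj C" and As: "set As \<subseteq> Obj C"
    using Cons.prems by auto
  have X: "?X \<in> Obj C" and Y: "?Y \<in> Obj C" and Q: "?Q \<in> Obj C"
    using As Bs P zero_Obj by (auto intro: product_Obj)
  note idA = Ident_Hom[OF A] and idX = Ident_Hom[OF X] and idP = Ident_Hom[OF P]
  have AB: "set (As @ Bs) \<subseteq> Obj C" using As Bs by simp
  have b1: "rebracket As ?Y \<in> Hom C (?X \<box> ?Y) (product (As @ Bs) zero)"
    using rebracket_Hom[OF As Y] by simp
  have b2: "rebracket (As @ Bs) P \<in> Hom C (product (As @ Bs) zero \<box> P) (product As ?Q)"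
    using rebracket_Hom[OF AB P] by simp
  note b3 = rebracket_Hom[OF As Q] and b4 = rebracket_Hom[OF Bs P]
  note e1 = eta_Hom[OF A X Y] and e2 = eta_Hom[OF A tensor_Obj[OF X Y] P]
    and e3 = eta_Hom[OF X Y P] and e4 = eta_Hom[OF A X tensor_Obj[OF Y P]]
    and e5 = eta_Hom[OF tensor_Obj[OF A X] Y P] and e6 = eta_Hom[OF A X Q]
  note Xb4 = tensor_Hom[OF idX b4]
  have outer: "rebracket (A # As @ Bs) P =
      (Ident C A \<otimes> rebracket (As @ Bs) P) \<cdot> \<eta> A (product (As @ Bs) zero) P"
    by simp
  have inner: "rebracket (A # As) ?Y \<otimes> Ident C P =
      ((Ident C A \<otimes> rebracket As ?Y) \<otimes> Ident C P) \<cdot> (\<eta> A ?X ?Y \<otimes> Ident C P)"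
    using interchange[OF e1 tensor_Hom[OF idA b1] idP idP] by (simp add: Ident_Comp[OF idP])
  have Ab1: "((Ident C A \<otimes> rebracket As ?Y) \<otimes> Ident C P) \<in>
      Hom C ((A \<box> ?X \<box> ?Y) \<box> P) ((A \<box> product (As @ Bs) zero) \<box> P)"
    by (rule tensor_Hom[OF tensor_Hom[OF idA b1] idP])
  have "product (As @ Bs) zero \<in> Obj C"
    using AB zero_Obj by (rule product_Obj)
  then have out_Hom: "rebracket (A # As @ Bs) P \<in>
      Hom C ((A \<box> product (As @ Bs) zero) \<box> P) (A \<box> product As ?Q)"
    unfolding outer by (rule Comp_Hom[OF eta_Hom[OF A _ P] tensor_Hom[OF idA b2]])
  have "rebracket ((A # As) @ Bs) P \<cdot> (rebracket (A # As) ?Y \<otimes> Ident C P) =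
      rebracket (A # As @ Bs) P \<cdot> ((Ident C A \<otimes> rebracket As ?Y) \<otimes> Ident C P) \<cdot>
        (\<eta> A ?X ?Y \<otimes> Ident C P)"
    unfolding inner append_Cons
    by (rule Comp_assoc[symmetric, OF tensor_Hom[OF e1 idP] Ab1 out_Hom])
  also have "\<dots> = (Ident C A \<otimes> (rebracket (As @ Bs) P \<cdot> (rebracket As ?Y \<otimes> Ident C P))) \<cdot>
      \<eta> A (?X \<box> ?Y) P \<cdot> (\<eta> A ?X ?Y \<otimes> Ident C P)"
    unfolding outer eta_rebracket[OF A P b1 b2] ..
  \<comment> \<open>The induction hypothesis, with the recursion at \<open>?X # Bs\<close> written
    out to expose the \<eta> at \<open>?X\<close>, \<open>?Y\<close>, \<open>P\<close>.\<close>
  also have "rebracket (As @ Bs) P \<cdot> (rebracket As ?Y \<otimes> Ident C P) =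
      rebracket As ?Q \<cdot> (Ident C ?X \<otimes> rebracket Bs P) \<cdot> \<eta> ?X ?Y P"
    using Cons.IH[OF As] Comp_assoc[OF e3 Xb4 b3] by simp
  also have "Ident C A \<otimes> \<dots> =
      (Ident C A \<otimes> rebracket As ?Q) \<cdot> (Ident C A \<otimes> Ident C ?X \<otimes> rebracket Bs P) \<cdot>
        (Ident C A \<otimes> \<eta> ?X ?Y P)"
    using interchange[OF idA idA Xb4 b3] interchange[OF idA idA e3 Comp_Hom[OF Xb4 b3]]
    by (simp add: Ident_Comp[OF idA])
  \<comment> \<open>Regrouping brings together the three \<eta> factors that form the long side of
    the pentagon.\<close>
  also have "\<dots> \<cdot> \<eta> A (?X \<box> ?Y) P \<cdot> (\<eta> A ?X ?Y \<otimes> Ident C P) =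
      (Ident C A \<otimes> rebracket As ?Q) \<cdot> (Ident C A \<otimes> Ident C ?X \<otimes> rebracket Bs P) \<cdot>
        ((Ident C A \<otimes> \<eta> ?X ?Y P) \<cdot> \<eta> A (?X \<box> ?Y) P \<cdot> (\<eta> A ?X ?Y \<otimes> Ident C P))"
  proof -
    let ?u = "(Ident C A \<otimes> rebracket As ?Q) \<cdot> (Ident C A \<otimes> Ident C ?X \<otimes> rebracket Bs P)"
    have u: "?u \<in> Hom C (A \<box> ?X \<box> ?Y \<box> P) (A \<box> product As ?Q)"
      by (rule Comp_Hom[OF tensor_Hom[OF idA Xb4] tensor_Hom[OF idA b3]])
    note Ae3 = tensor_Hom[OF idA e3]
    show ?thesis
      by (simp only: Comp_assoc[OF e2 Ae3 u]
          Comp_assoc[OF tensor_Hom[OF e1 idP] Comp_Hom[OF e2 Ae3] u])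
  qed
  also have "(Ident C A \<otimes> \<eta> ?X ?Y P) \<cdot> \<eta> A (?X \<box> ?Y) P \<cdot> (\<eta> A ?X ?Y \<otimes> Ident C P) =
      \<eta> A ?X (?Y \<box> P) \<cdot> \<eta> (A \<box> ?X) ?Y P"
    by (rule pentagon[OF A X Y P, symmetric])
  also have "(Ident C A \<otimes> rebracket As ?Q) \<cdot> (Ident C A \<otimes> Ident C ?X \<otimes> rebracket Bs P) \<cdot> \<dots> =
      (Ident C A \<otimes> rebracket As ?Q) \<cdot>
        ((Ident C A \<otimes> Ident C ?X \<otimes> rebracket Bs P) \<cdot> \<eta> A ?X (?Y \<box> P)) \<cdot> \<eta> (A \<box> ?X) ?Y P"
    by (simp only: Comp_assoc[OF e4 tensor_Hom[OF idA Xb4] tensor_Hom[OF idA b3]]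
        Comp_assoc[OF e5 e4 Comp_Hom[OF tensor_Hom[OF idA Xb4] tensor_Hom[OF idA b3]],
          symmetric])
  \<comment> \<open>Naturality of \<eta> in its last argument moves the opening of \<open>Bs\<close>
    between the two remaining \<eta>; each half is then one recursion step of
    \<open>rebracket\<close>.\<close>
  also have "(Ident C A \<otimes> Ident C ?X \<otimes> rebracket Bs P) \<cdot> \<eta> A ?X (?Y \<box> P) =
      \<eta> A ?X ?Q \<cdot> (Ident C (A \<box> ?X) \<otimes> rebracket Bs P)"
    using eta_naturality[OF idA idX b4] by (simp add: tensor_Ident[OF A X])
  also have "(Ident C A \<otimes> rebracket As ?Q) \<cdot> \<dots> \<cdot> \<eta> (A \<box> ?X) ?Y P =
      rebracket (A # As) ?Q \<cdot> rebracket (product (A # As) zero # Bs) P"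
  proof -
    note AXb4 = tensor_Hom[OF Ident_Hom[OF tensor_Obj[OF A X]] b4] and Ab3 = tensor_Hom[OF idA b3]
    show ?thesis
      using Comp_assoc[OF AXb4 e6 Ab3] Comp_assoc[OF e5 AXb4 Comp_Hom[OF e6 Ab3]] by simp
  qed
  finally show ?case .
qed

text \<open>Induction through \<open>eta_rebracket\<close> passes the prefix \<open>As\<close>; the
  case of an empty prefix is \<open>rebracket_append\<close>.\<close>

lemma rebracket_nested:
  assumes "set As \<subseteq> Obj C" "set Bs \<subseteq> Obj C" "set Cs \<subseteq> Obj C" and P: "P \<in> Obj C"
  shows "rebracket (As @ Bs @ Cs) P \<cdot>
      (whisker As (rebracket Bs (product Cs zero)) \<otimes> Ident C P) =
    whisker As (rebracket Bs (product Cs P)) \<cdot> rebracket (As @ product Bs zero # Cs) P"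
  using assms(1)
proof (induction As)
  case Nil
  show ?case
    using rebracket_append[OF assms(2-4)] by simp
next
  case (Cons A As)
  let ?Y = "product Cs zero" and ?Q = "product Cs P" and ?M = "product Bs zero"
  have A: "A \<in> Obj C" and As: "set As \<subseteq> Obj C"
    using Cons.prems by auto
  have Y: "?Y \<in> Obj C" and Q: "?Q \<in> Obj C" and M: "?M \<in> Obj C"
    using assms zero_Obj by (auto intro: product_Obj)
  note idA = Ident_Hom[OF A]
  have w1: "whisker As (rebracket Bs ?Y) \<in> Hom C (product (As @ ?M # Cs) zero)
      (product (As @ Bs @ Cs) zero)"
    using whisker_Hom[OF As rebracket_Hom[OF assms(2) Y]] by simp
  have w2: "whisker As (rebracket Bs ?Q) \<in> Hom C (product (As @ ?M # Cs) P)
      (product (As @ Bs @ Cs) P)"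
    using whisker_Hom[OF As rebracket_Hom[OF assms(2) Q]] by simp
  have sets: "set (As @ Bs @ Cs) \<subseteq> Obj C" "set (As @ ?M # Cs) \<subseteq> Obj C"
    using As assms M by auto
  note r1 = rebracket_Hom[OF sets(1) P] and r2 = rebracket_Hom[OF sets(2) P]
  have e: "\<eta> A (product (As @ ?M # Cs) zero) P \<in> Hom C
      ((A \<box> product (As @ ?M # Cs) zero) \<box> P) (A \<box> product (As @ ?M # Cs) zero \<box> P)"
    using product_Obj[OF sets(2) zero_Obj] by (rule eta_Hom[OF A _ P])
  have "rebracket ((A # As) @ Bs @ Cs) P \<cdot>
      (whisker (A # As) (rebracket Bs ?Y) \<otimes> Ident C P) =
      (Ident C A \<otimes> (rebracket (As @ Bs @ Cs) P \<cdot>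
        (whisker As (rebracket Bs ?Y) \<otimes> Ident C P))) \<cdot> \<eta> A (product (As @ ?M # Cs) zero) P"
    using eta_rebracket[OF A P w1 r1] by simp
  also have "\<dots> = (Ident C A \<otimes> (whisker As (rebracket Bs ?Q) \<cdot>
        rebracket (As @ ?M # Cs) P)) \<cdot> \<eta> A (product (As @ ?M # Cs) zero) P"
    using Cons.IH[OF As] by simp
  also have "\<dots> = (Ident C A \<otimes> whisker As (rebracket Bs ?Q)) \<cdot>
        (Ident C A \<otimes> rebracket (As @ ?M # Cs) P) \<cdot> \<eta> A (product (As @ ?M # Cs) zero) P"
    using interchange[OF idA idA r2 w2] by (simp add: Ident_Comp[OF idA])
  also have "\<dots> = whisker (A # As) (rebracket Bs ?Q) \<cdot> rebracket ((A # As) @ ?M # Cs) P"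
    using Comp_assoc[OF e tensor_Hom[OF idA r2] tensor_Hom[OF idA w2]] by simp
  finally show ?case .
qed

section \<open>The A-infinity structure\<close>

definition mu :: "nat \<Rightarrow> ('o list, 'm list, 'o, 'm) functr"
  where "mu k = \<lparr>fobj = (\<lambda>As. product As zero), fmor = (\<lambda>fs. product_mor fs (Ident C zero))\<rparr>"

definition alpha :: "nat \<Rightarrow> nat \<Rightarrow> nat \<Rightarrow> 'o list \<Rightarrow> 'm"
  where "alpha i j k As = whisker (take i As)
    (rebracket (take j (drop i As)) (product (drop (i + j) As) zero))"

lemma mu_simps [simp]:
  "fobj (mu k) As = product As zero" "fmor (mu k) fs = product_mor fs (Ident C zero)"
  by (simp_all add: mu_def)

lemma alpha_append:
  "\<lbrakk>length As = i; length Bs = j\<rbrakk> \<Longrightarrow>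
    alpha i j k (As @ Bs @ Cs) = whisker As (rebracket Bs (product Cs zero))"
  by (auto simp: alpha_def)

lemma list_split3:
  assumes "length xs = i + j + k"
  obtains as bs cs where "xs = as @ bs @ cs" "length as = i" "length bs = j" "length cs = k"
proof
  show "xs = take i xs @ take j (drop i xs) @ drop (i + j) xs"
    by (metis append_take_drop_id drop_drop add.commute)
qed (use assms in auto)

lemma mu_functor: "is_functor (pow_cat C k) C (mu k)"
proof -
  interpret pow: category "pow_cat C k" by (rule category_pow_cat)
  note id = Ident_Hom[OF zero_Obj]
  show ?thesis
  proof unfold_locales
    show "fobj (mu k) As \<in> Obj C" if "As \<in> Obj (pow_cat C k)" for As
      using that by (simp add: product_Obj zero_Obj)
    show "fmor (mu k) fs \<in> Hom C (fobj (mu k) As) (fobj (mu k) Bs)"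
      if "fs \<in> Hom (pow_cat C k) As Bs" for fs As Bs
      using that product_Hom[OF _ id] by (auto simp: Hom_pow_cat)
    show "fmor (mu k) (Ident (pow_cat C k) As) = Ident C (fobj (mu k) As)"
      if "As \<in> Obj (pow_cat C k)" for As
      using that by (simp add: Ident_pow_cat product_Ident zero_Obj)
    show "fmor (mu k) (Comp (pow_cat C k) gs fs) = fmor (mu k) gs \<cdot> fmor (mu k) fs"
      if "fs \<in> Hom (pow_cat C k) As Bs" "gs \<in> Hom (pow_cat C k) Bs Cs" for fs gs As Bs Cs
      using that product_Comp[OF _ _ _ id id, of fs gs]
      by (auto simp: Hom_pow_cat Comp_pow_cat Ident_Comp[OF id])
  qed
qed

lemma mu_unit: "functr_eq (pow_cat C (i + j)) (mu (i + 1 + j) \<circ>\<circ> at_slot i 0 (mu 0)) (mu (i + j))"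
proof -
  have "product (take i As @ zero # drop i As) zero = product As zero"
    if "set As \<subseteq> Obj C" for As
  proof -
    have "set (take i As) \<subseteq> Obj C" "set (drop i As) \<subseteq> Obj C"
      using that set_take_subset[of i As] set_drop_subset[of i As] by auto
    from product_unit[OF this zero_Obj] show ?thesis
      by (simp only: append_take_drop_id)
  qed
  \<comment> \<open>The empty product of morphisms is \<open>Ident C zero\<close>, so this is what
    \<open>at_slot i 0 (mu 0)\<close> inserts.\<close>
  moreover have "product_mor (take i fs @ Ident C zero # drop i fs) (Ident C zero) =
      product_mor fs (Ident C zero)" if "set fs \<subseteq> Mor C" for fs
  proof -
    have "set (drop i fs) \<subseteq> Mor C"
      by (rule order_trans[OF set_drop_subset that])
    then have "Ident C zero \<otimes> product_mor (drop i fs) (Ident C zero) =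
        product_mor (drop i fs) (Ident C zero)"
      by (rule unit_Hom(1)[OF product_Hom[OF _ Ident_Hom[OF zero_Obj]]])
    then have "product_mor (take i fs @ Ident C zero # drop i fs) (Ident C zero) =
        product_mor (take i fs @ drop i fs) (Ident C zero)"
      by (simp only: foldr_append foldr.simps o_apply)
    then show ?thesis
      by (simp only: append_take_drop_id)
  qed
  ultimately show ?thesis
    by (auto simp: functr_eq_def functr_comp_def at_slot_def pow_cat_def)
qed

text \<open>The identities on the first block are absorbed into \<open>product_mor as\<close>. Under
  it the claim is \<open>rebracket_natural\<close> for the middle block, with the product of
  \<open>cs\<close> as the morphism between end objects.\<close>

lemma alpha_natural:
  "nat_transf (pow_cat C (i + j + k)) C
    (mu (i + 1 + k) \<circ>\<circ> at_slot i j (mu j)) (mu (i + j + k)) (alpha i j k)"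
proof -
  interpret F: is_functor "pow_cat C (i + j + k)" C "mu (i + 1 + k) \<circ>\<circ> at_slot i j (mu j)"
    by (rule is_functor_comp[OF is_functor_at_slot[OF mu_functor] mu_functor])
  interpret G: is_functor "pow_cat C (i + j + k)" C "mu (i + j + k)"
    by (rule mu_functor)
  show ?thesis
  proof unfold_locales
    fix Xs assume Xs: "Xs \<in> Obj (pow_cat C (i + j + k))"
    then have "length Xs = i + j + k" by simp
    then obtain As Bs Cs where eq: "Xs = As @ Bs @ Cs"
      and len: "length As = i" "length Bs = j" "length Cs = k"
      by (rule list_split3)
    have sets: "set As \<subseteq> Obj C" "set Bs \<subseteq> Obj C" "set Cs \<subseteq> Obj C"
      using Xs eq by auto
    show "alpha i j k Xs \<in> Hom C (fobj (mu (i + 1 + k) \<circ>\<circ> at_slot i j (mu j)) Xs)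
        (fobj (mu (i + j + k)) Xs)"
      using len whisker_Hom[OF sets(1) rebracket_Hom[OF sets(2) product_Obj[OF sets(3) zero_Obj]]]
      by (simp add: eq alpha_append functr_comp_def at_slot_def)
  next
    fix hs Xs Ys assume hs: "hs \<in> Hom (pow_cat C (i + j + k)) Xs Ys"
    then have "length hs = i + j + k" by (simp add: Hom_pow_cat)
    then obtain as bs cs where eq: "hs = as @ bs @ cs"
      and len: "length as = i" "length bs = j" "length cs = k"
      by (rule list_split3)
    have as: "set as \<subseteq> Mor C" and bs: "set bs \<subseteq> Mor C" and cs: "set cs \<subseteq> Mor C"
      and Xs: "Xs = map (Dom C) as @ map (Dom C) bs @ map (Dom C) cs"
      and Ys: "Ys = map (Cod C) as @ map (Cod C) bs @ map (Cod C) cs"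
      using hs by (auto simp: eq Hom_pow_cat)
    let ?c = "product_mor cs (Ident C zero)" and ?b = "product_mor bs (Ident C zero)"
    let ?P = "product (map (Dom C) cs) zero" and ?Q = "product (map (Cod C) cs) zero"
    note id = Ident_Hom[OF zero_Obj]
    note c = product_Hom[OF cs id] and b = product_Hom[OF bs id]
    note rD = rebracket_Hom[OF map_Dom_Obj[OF bs] Hom_Obj(1)[OF c]]
      and rC = rebracket_Hom[OF map_Cod_Obj[OF bs] Hom_Obj(2)[OF c]]
    have "alpha i j k Ys \<cdot> fmor (mu (i + 1 + k) \<circ>\<circ> at_slot i j (mu j)) hs =
        whisker (map (Cod C) as) (rebracket (map (Cod C) bs) ?Q) \<cdot> product_mor as (?b \<otimes> ?c)"
      using len by (simp add: eq Ys alpha_append functr_comp_def at_slot_def)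
    also have "\<dots> = product_mor as (rebracket (map (Cod C) bs) ?Q \<cdot> (?b \<otimes> ?c))"
      by (rule whisker_product[OF as tensor_Hom[OF b c] rC])
    also have "\<dots> = product_mor as (product_mor bs ?c \<cdot> rebracket (map (Dom C) bs) ?P)"
      by (simp only: rebracket_natural[OF bs c])
    also have "\<dots> = product_mor as (product_mor bs ?c) \<cdot>
        whisker (map (Dom C) as) (rebracket (map (Dom C) bs) ?P)"
      by (rule product_whisker[symmetric, OF as rD product_Hom[OF bs c]])
    also have "\<dots> = fmor (mu (i + j + k)) hs \<cdot> alpha i j k Xs"
      using len by (simp add: eq Xs alpha_append)
    finally show "alpha i j k Ys \<cdot> fmor (mu (i + 1 + k) \<circ>\<circ> at_slot i j (mu j)) hs =
        fmor (mu (i + j + k)) hs \<cdot> alpha i j k Xs" .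
  qed
qed

section \<open>Coherence conditions\<close>

text \<open>Supplies condition (ii), where the extra \<open>zero\<close> lies in the block that only
  whiskers.\<close>

lemma whisker_unit:
  assumes "set As \<subseteq> Obj C" "set Bs \<subseteq> Obj C" "f \<in> Hom C P Q"
  shows "whisker (As @ zero # Bs) f = whisker (As @ Bs) f"
  using unit_Hom(1)[OF whisker_Hom[OF assms(2,3)]] by simp

text \<open>Condition (v), with \<open>P\<close> standing for the product of the last block. Under
  the whiskering by \<open>As\<close> it is naturality of \<open>rebracket Bs\<close> along the
  morphism that opens \<open>Ds\<close> behind \<open>Cs\<close>.\<close>

lemma alpha_disjoint:
  assumes As: "set As \<subseteq> Obj C" and Bs: "set Bs \<subseteq> Obj C" and Cs: "set Cs \<subseteq> Obj C"
    and Ds: "set Ds \<subseteq> Obj C" and P: "P \<in> Obj C"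
  shows "whisker (As @ Bs @ Cs) (rebracket Ds P) \<cdot>
      whisker As (rebracket Bs (product Cs (product Ds zero \<box> P))) =
    whisker As (rebracket Bs (product Cs (product Ds P))) \<cdot>
      whisker (As @ product Bs zero # Cs) (rebracket Ds P)"
proof -
  note r = whisker_Hom[OF Cs rebracket_Hom[OF Ds P]]
  note r' = rebracket_Hom[OF Bs Hom_Obj(1)[OF r]] rebracket_Hom[OF Bs Hom_Obj(2)[OF r]]
  have B: "product Bs zero \<in> Obj C"
    using Bs zero_Obj by (rule product_Obj)
  show ?thesis
    using whisker_Comp[OF As r'(1) whisker_Hom[OF Bs r]]
      whisker_Comp[OF As tensor_Hom[OF Ident_Hom[OF B] r] r'(2)] rebracket_whisker[OF Bs r]
    by simp
qed

text \<open>Condition (vi), with \<open>P\<close> as before. The block \<open>As\<close> only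
  whiskers, and what remains is \<open>rebracket_nested\<close>.\<close>

lemma alpha_nested:
  assumes As: "set As \<subseteq> Obj C" and Bs: "set Bs \<subseteq> Obj C" and Cs: "set Cs \<subseteq> Obj C"
    and Ds: "set Ds \<subseteq> Obj C" and P: "P \<in> Obj C"
  shows "whisker As (rebracket (Bs @ Cs @ Ds) P) \<cdot>
      whisker As (whisker Bs (rebracket Cs (product Ds zero)) \<otimes> Ident C P) =
    whisker (As @ Bs) (rebracket Cs (product Ds P)) \<cdot>
      whisker As (rebracket (Bs @ product Cs zero # Ds) P)"
proof -
  have C: "product Cs zero \<in> Obj C" and D: "product Ds zero \<in> Obj C" and Q: "product Ds P \<in> Obj C"
    using Cs Ds P zero_Obj by (auto intro: product_Obj)
  have sets: "set (Bs @ Cs @ Ds) \<subseteq> Obj C" "set (Bs @ product Cs zero # Ds) \<subseteq> Obj C"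
    using Bs Cs Ds C by auto
  have inner: "whisker Bs (rebracket Cs (product Ds zero)) \<otimes> Ident C P \<in> Hom C
      (product (Bs @ product Cs zero # Ds) zero \<box> P) (product (Bs @ Cs @ Ds) zero \<box> P)"
    using tensor_Hom[OF whisker_Hom[OF Bs rebracket_Hom[OF Cs D]] Ident_Hom[OF P]] by simp
  have outer: "whisker Bs (rebracket Cs (product Ds P)) \<in> Hom C
      (product (Bs @ product Cs zero # Ds) P) (product Bs (product Cs (product Ds P)))"
    using whisker_Hom[OF Bs rebracket_Hom[OF Cs Q]] by simp
  show ?thesis
    using whisker_Comp[OF As inner rebracket_Hom[OF sets(1) P]]
      whisker_Comp[OF As rebracket_Hom[OF sets(2) P] outer] rebracket_nested[OF Bs Cs Ds P]
    by simp
qed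

lemma A_infinity_monoidal_mu_alpha: "A_infinity_monoidal C mu alpha"
proof (intro A_infinity_monoidal.intro A_infinity_monoidal_axioms.intro)
  show "category C"
    by (rule category_axioms)
  show "is_functor (pow_cat C k) C (mu k)" for k
    by (rule mu_functor)
  have "product_mor [f] (Ident C zero) = f" if "f \<in> Mor C" for f
    using unit_Hom(2)[OF Mor_Hom[OF that]] by simp
  then show "functr_eq (pow_cat C 1) (mu 1) \<lparr>fobj = (\<lambda>As. As ! 0), fmor = (\<lambda>fs. fs ! 0)\<rparr>"
    by (auto simp: functr_eq_def pow_cat_def length_Suc_conv unit_Obj)
  show "functr_eq (pow_cat C (i + j)) (mu (i + 1 + j) \<circ>\<circ> at_slot i 0 (mu 0)) (mu (i + j))" for i j
    by (rule mu_unit)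
  show "nat_transf (pow_cat C (i + j + k)) C
      (mu (i + 1 + k) \<circ>\<circ> at_slot i j (mu j)) (mu (i + j + k)) (alpha i j k)" for i j k
    by (rule alpha_natural)
  show "alpha i 0 k X = Ident C (fobj (mu (i + k)) X)" if "X \<in> Obj (pow_cat C (i + k))" for i k X
  proof -
    have "length X = i + 0 + k" using that by simp
    then obtain As Bs Cs where "X = As @ Bs @ Cs" "length As = i" "length Bs = 0"
      by (rule list_split3)
    then show ?thesis
      using that by (simp add: alpha_def product_Ident product_Obj zero_Obj)
  qed
  show "alpha i 1 k X = Ident C (fobj (mu (i + 1 + k)) X)"
    if "X \<in> Obj (pow_cat C (i + 1 + k))" for i k X
  proof -
    have "length X = i + 1 + k" using that by simp
    then obtain As Bs Cs where "X = As @ Bs @ Cs" "length As = i" "length Bs = 1"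
      by (rule list_split3)
    moreover from this obtain B where "Bs = [B]"
      by (auto simp: length_Suc_conv)
    ultimately show ?thesis
      using that
      by (simp add: alpha_def product_Ident product_Obj tensor_Obj zero_Obj rebracket_singleton
          del: rebracket.simps(2))
  qed
  show "alpha 0 j 0 X = Ident C (fobj (mu j) X)" if "X \<in> Obj (pow_cat C j)" for j X
    using that by (simp add: alpha_def rebracket_zero)
  fix a b c d e X Y Z W V
  assume X: "X \<in> Obj (pow_cat C a)" and Y: "Y \<in> Obj (pow_cat C b)"
    and Z: "Z \<in> Obj (pow_cat C c)" and W: "W \<in> Obj (pow_cat C d)"
  have W0: "product W zero \<in> Obj C"
    using W zero_Obj by (simp add: product_Obj)
  show "alpha (a + b + 1) c d ((X @ [fobj (mu 0) []] @ Y) @ Z @ W) =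
      alpha (a + b) c d ((X @ Y) @ Z @ W)"
    using X Y Z whisker_unit[OF _ _ rebracket_Hom[OF _ W0], of X Y Z]
    by (subst (1 2) alpha_append) auto
  \<comment> \<open>The extra \<open>zero\<close> enters only the end object of the rebracketing,
    which \<open>product_unit\<close> leaves unchanged.\<close>
  show "alpha a b (c + d + 1) (X @ Y @ (Z @ [fobj (mu 0) []] @ W)) =
      alpha a b (c + d) (X @ Y @ (Z @ W))"
    using X Y Z W product_unit[of Z W zero] zero_Obj
    by (subst (1 2) alpha_append) auto
  show "alpha a (b + c + 1) d (X @ (Y @ [fobj (mu 0) []] @ Z) @ W) =
      alpha a (b + c) d (X @ (Y @ Z) @ W)"
    using X Y Z rebracket_unit[OF _ _ W0, of Y Z]
    by (subst (1 2) alpha_append) auto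
  assume V: "V \<in> Obj (pow_cat C e)"
  have V0: "product V zero \<in> Obj C"
    using V zero_Obj by (simp add: product_Obj)
  show "alpha (a + b + c) d e ((X @ Y @ Z) @ W @ V) \<cdot>
      alpha a b (c + e + 1) (X @ Y @ (Z @ [fobj (mu d) W] @ V)) =
    alpha a b (c + d + e) (X @ Y @ (Z @ W @ V)) \<cdot>
      alpha (a + c + 1) d e ((X @ [fobj (mu b) Y] @ Z) @ W @ V)"
    using X Y Z W alpha_disjoint[OF _ _ _ _ V0, of X Y Z W]
    by (subst (1 2 3 4) alpha_append) auto
  \<comment> \<open>The identities on \<open>V\<close> collapse to the identity of
    \<open>product V zero\<close>, which is the \<open>P\<close> of
    \<open>alpha_nested\<close>.\<close>
  show "alpha a (b + c + d) e (X @ (Y @ Z @ W) @ V) \<cdot>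
      fmor (mu (a + e + 1)) (map (Ident C) X @ [alpha b c d (Y @ Z @ W)] @ map (Ident C) V) =
    alpha (a + b) c (d + e) ((X @ Y) @ Z @ (W @ V)) \<cdot>
      alpha a (b + d + 1) e (X @ (Y @ [fobj (mu c) Z] @ W) @ V)"
    using X Y Z W V alpha_nested[OF _ _ _ _ V0, of X Y Z W]
    by (subst (1 2 3 4) alpha_append) (auto simp: product_Ident zero_Obj)
qed

text \<open>The recursion is unfolded only at \<open>X\<close>: the inner rebracketing has the
  singleton block \<open>[Y]\<close>, hence is an identity, and the occurrences of
  \<open>zero\<close> in the arguments of \<eta> vanish by strictness.\<close>

lemma alpha_eta:
  assumes "X \<in> Obj C" "Y \<in> Obj C" "Z \<in> Obj C"
  shows "alpha 0 2 1 [X, Y, Z] = \<eta> X Y Z"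
  using assms eta_Hom[OF assms]
  by (simp add: alpha_def rebracket_singleton unit_Obj tensor_Ident tensor_Obj Ident_Comp
      del: rebracket.simps(2) add: rebracket.simps(2)[of X])

end

text \<open>The predicate \<open>A_infinity_monoidal C \<mu> \<alpha>\<close> does not mention
  \<open>T\<close>, \<open>zero\<close> or \<eta>; the further conjuncts say that the structure
  extends the given one.\<close>

theorem theorem3p3:
  fixes C :: "('o, 'm) category"
    and T :: "('o \<times> 'o, 'm \<times> 'm, 'o, 'm) functr"
    and zero :: 'o
    and \<eta> :: "'o \<Rightarrow> 'o \<Rightarrow> 'o \<Rightarrow> 'm"
  assumes "directed_monoidal C T zero \<eta>"
  shows "\<exists>\<mu> \<alpha>. A_infinity_monoidal C \<mu> \<alpha> \<and>
    fobj (\<mu> 0) [] = zero \<and>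
    (\<forall>X \<in> Obj C. \<forall>Y \<in> Obj C. fobj (\<mu> 2) [X, Y] = fobj T (X, Y)) \<and>
    (\<forall>f \<in> Mor C. \<forall>g \<in> Mor C. fmor (\<mu> 2) [f, g] = fmor T (f, g)) \<and>
    (\<forall>X \<in> Obj C. \<forall>Y \<in> Obj C. \<forall>Z \<in> Obj C. \<alpha> 0 2 1 [X, Y, Z] = \<eta> X Y Z)"
proof -
  interpret directed_monoidal C T zero \<eta> by fact
  \<comment> \<open>The product of \<open>f\<close> and \<open>g\<close> ends in
    \<open>Ident C zero\<close>, which the right unit law absorbs into \<open>g\<close>.\<close>
  have "fmor (mu 2) [f, g] = fmor T (f, g)" if "g \<in> Mor C" for f g
    using unit_Hom(2)[OF Mor_Hom[OF that]] by simp
  then show ?thesis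
    using A_infinity_monoidal_mu_alpha alpha_eta
    by (intro exI[of _ mu] exI[of _ alpha]) (simp add: unit_Obj)
qed

end
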